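(* For all integers $n\ge 0$ the following hold: \begin{align*} M_{k}(0,2,2n) &> M_{k}(1,2,2n) && \text{for } k=2,3,4,\\ M_{k}(1,2,2n+1) &> M_{k}(0,2,2n+1) && \text{for } k=2,3,\\ M_{4}(0,2,2n+1) &= M_{4}(1,2,2n+1), &&\\ M_{k}(0,2,n) &> M_{k}(1,2,n) && \text{for every integer } k\ge 5. \end{align*}
   Context: A partition is a finite weakly decreasing (possibly empty) sequence of positive integers, called its parts; $\ell(\pi)$ denotes the number of parts of the partition $\pi$. For an integer $k\ge 2$, a $k$-colored partition of $n\ge 0$ is an ordered $k$-tuple $\overrightarrow{\pi}=(\pi^{(1)},\pi^{(2)},\dots,\pi^{(k)})$ of partitions (each possibly empty) such that the sum of all parts of all the $\pi^{(i)}$ equals $n$. Its $k$-crank is defined as $\ell(\pi^{(1)})-\ell(\pi^{(2)})$. For $m\in\mathbb{Z}$, $M_k(m,n)$ denotes the number of $k$-colored partitions of $n$ with $k$-crank equal to $m$; equivalently, $$\sum_{n\ge 0}\sum_{m\in\mathbb{Z}}M_k(m,n)z^mq^n=\frac{(q;q)_\infty^{2-k}}{(zq;q)_\infty(z^{-1}q;q)_\infty},\qquad (a;q)_\infty:=\prod_{i\ge 0}(1-aq^i).$$ With three arguments, $M_k(r,m,n)$ denotes the number of $k$-colored partitions of $n$ whose $k$-crank is congruent to $r$ modulo $m$. *)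

theory Defs
  imports Complex_Main "HOL-Number_Theory.Cong"
begin

definition is_partition :: "nat list \<Rightarrow> bool" where
  "is_partition p \<longleftrightarrow> sorted_wrt (\<ge>) p \<and> (\<forall>x\<in>set p. 0 < x)"

definition colored_partitions :: "nat \<Rightarrow> nat \<Rightarrow> nat list list set" where
  "colored_partitions k n =
     {ps. length ps = k \<and> (\<forall>p\<in>set ps. is_partition p) \<and> (\<Sum>p\<leftarrow>ps. sum_list p) = n}"

text \<open>The components are 0-indexed here: \<open>ps ! 0\<close> and \<open>ps ! 1\<close> are the first and second
  partition of the tuple. The definition is only meaningful for tuples of length at least 2.\<close>

definition kcrank :: "nat list list \<Rightarrow> int" where
  "kcrank ps = int (length (ps ! 0)) - int (length (ps ! 1))"

text \<open>\<open>crank_count_mod k r m n\<close> is the number written $M_k(r,m,n)$: residue \<open>r\<close>, modulus \<open>m\<close>.\<close>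

definition crank_count_mod :: "nat \<Rightarrow> int \<Rightarrow> int \<Rightarrow> nat \<Rightarrow> nat" where
  "crank_count_mod k r m n = card {ps \<in> colored_partitions k n. [kcrank ps = r] (mod m)}"

text \<open>There are only finitely many \<open>k\<close>-colored partitions of \<open>n\<close>, so \<^const>\<open>card\<close> really counts.\<close>

lemma is_partition_length_le: "is_partition p \<Longrightarrow> length p \<le> sum_list p"
  unfolding is_partition_def by (induction p) (auto simp: Suc_le_eq)

lemma finite_colored_partitions: "finite (colored_partitions k n)"
proof (rule finite_subset)
  let ?P = "{p. set p \<subseteq> {..n} \<and> length p \<le> n}"
  show "colored_partitions k n \<subseteq> {ps. set ps \<subseteq> ?P \<and> length ps = k}"
  proof
    fix ps assume ps: "ps \<in> colored_partitions k n"
    have "p \<in> ?P" if p: "p \<in> set ps" for p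
    proof -
      have le: "sum_list p \<le> n"
        using ps p member_le_sum_list[of "sum_list p" "map sum_list ps"]
        by (auto simp: colored_partitions_def)
      moreover have "length p \<le> sum_list p"
        using ps p is_partition_length_le by (auto simp: colored_partitions_def)
      ultimately show ?thesis
        using member_le_sum_list[of _ p] by fastforce
    qed
    then show "ps \<in> {ps. set ps \<subseteq> ?P \<and> length ps = k}"
      using ps by (auto simp: colored_partitions_def)
  qed
  show "finite {ps. set ps \<subseteq> ?P \<and> length ps = k}"
    by (intro finite_lists_length_eq finite_lists_length_le finite_atMost)
qed

end

theory Submission
  imports Defs "HOL-Computational_Algebra.Formal_Power_Series"
begin

unbundle fps_syntax

text \<open>
  Setting \<open>z = -1\<close> in the generating function shows that \<open>M\<^sub>k(0,2,n) - M\<^sub>k(1,2,n)\<close> is the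
  coefficient of \<open>q\<^sup>n\<close> in \<open>S\<^sup>2 P\<^bsup>k-2\<^esup>\<close>, where \<open>P = \<Prod> 1/(1-q\<^sup>i)\<close> and \<open>S = \<Prod> 1/(1+q\<^sup>i)\<close>. Now
  \<open>E = P S = \<Prod> 1/(1-q\<^bsup>2i\<^esup>)\<close> is supported on the even exponents and positive there, and by Euler
  \<open>S = \<Prod> (1-q\<^bsup>2i-1\<^esup>)\<close>, so the coefficients of \<open>S(-q)\<close> are nonnegative, and positive at \<open>0\<close> and at
  all odd exponents. The four claims are read off from \<open>S\<^sup>2\<close>, \<open>S E\<close>, \<open>E\<^sup>2\<close> and \<open>E\<^sup>2 P\<^bsup>k-4\<^esup>\<close>.
  All parts are bounded by some \<open>N \<ge> n\<close>, which makes the products finite.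
\<close>

lemma fps_prod_nth_0: "prod f A $ 0 = (\<Prod>i\<in>A. f i $ 0)"
  by (induction A rule: infinite_finite_induct) auto

section \<open>Generating functions of tuples of partitions\<close>

definition tuples :: "nat list set \<Rightarrow> nat \<Rightarrow> nat \<Rightarrow> nat list list set" where
  "tuples Q k n = {ps. length ps = k \<and> set ps \<subseteq> Q \<and> (\<Sum>p\<leftarrow>ps. sum_list p) = n}"

definition length_gf :: "nat list set \<Rightarrow> 'a::comm_semiring_1 \<Rightarrow> 'a fps" where
  "length_gf Q z = Abs_fps (\<lambda>n. \<Sum>p\<in>{p\<in>Q. sum_list p = n}. z ^ length p)"

lemma tuples_0: "tuples Q 0 n = (if n = 0 then {[]} else {})"
  by (auto simp: tuples_def)

text \<open>The redundant index \<open>i\<close>, which is the sum of the first component, gives a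
  sum over this set the shape of a Cauchy product.\<close>

lemma tuples_Suc:
  "tuples Q (Suc k) n =
     (\<lambda>(i, p, ps). p # ps) ` (SIGMA i:{..n}. {p\<in>Q. sum_list p = i} \<times> tuples Q k (n - i))"
proof (intro set_eqI iffI)
  fix x assume "x \<in> tuples Q (Suc k) n"
  then obtain p ps where "x = p # ps" "p \<in> Q" "ps \<in> tuples Q k (n - sum_list p)" "sum_list p \<le> n"
    by (auto simp: tuples_def length_Suc_conv)
  then show "x \<in> (\<lambda>(i, p, ps). p # ps) `
      (SIGMA i:{..n}. {p\<in>Q. sum_list p = i} \<times> tuples Q k (n - i))"
    by (intro image_eqI[of _ _ "(sum_list p, p, ps)"]) auto
qed (auto simp: tuples_def)

lemma finite_tuples:
  assumes "\<And>i. finite {p\<in>Q. sum_list p = i}"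
  shows "finite (tuples Q k n)"
proof (induction k arbitrary: n)
  case (Suc k)
  then show ?case
    unfolding tuples_Suc using assms by (intro finite_imageI finite_SigmaI finite_cartesian_product) auto
qed (simp add: tuples_0)

text \<open>The weight is multiplicative over components, so splitting off the first one is a Cauchy
  product. A separate weight for each component allows -1 in the two that enter the crank and 1
  elsewhere.\<close>

lemma sum_tuples_eq_prod_length_gf:
  fixes zs :: "'a::comm_semiring_1 list"
  assumes fin: "\<And>i. finite {p\<in>Q. sum_list p = i}"
  shows "(\<Sum>ps\<in>tuples Q (length zs) n. \<Prod>(z, p)\<leftarrow>zip zs ps. z ^ length p) =
         (\<Prod>z\<leftarrow>zs. length_gf Q z) $ n"
proof (induction zs arbitrary: n)
  case Nil
  then show ?case by (simp add: tuples_0)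
next
  case (Cons z zs)
  let ?w = "\<lambda>ps. \<Prod>(z, p)\<leftarrow>zip zs ps. z ^ length p"
  let ?Q = "\<lambda>i. {p\<in>Q. sum_list p = i}"
  let ?S = "SIGMA i:{..n}. ?Q i \<times> tuples Q (length zs) (n - i)"
  have inj: "inj_on (\<lambda>(i, p, ps). p # ps) ?S"
    by (auto simp: inj_on_def)
  have "(\<Sum>ps\<in>tuples Q (length (z # zs)) n. \<Prod>(z, p)\<leftarrow>zip (z # zs) ps. z ^ length p) =
        (\<Sum>(i, p, ps)\<in>?S. z ^ length p * ?w ps)"
    unfolding length_Cons tuples_Suc by (subst sum.reindex[OF inj]) (auto intro!: sum.cong)
  also have "\<dots> = (\<Sum>i\<le>n. \<Sum>(p, ps)\<in>?Q i \<times> tuples Q (length zs) (n - i). z ^ length p * ?w ps)"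
    using fin finite_tuples[of Q] by (subst sum.Sigma) auto
  also have "\<dots> = (\<Sum>i\<le>n. length_gf Q z $ i * (\<Prod>z\<leftarrow>zs. length_gf Q z) $ (n - i))"
    unfolding Cons.IH[symmetric]
    by (simp add: length_gf_def sum_product sum.cartesian_product)
  finally show ?case
    by (simp add: fps_mult_nth atLeast0AtMost)
qed

section \<open>Generating function of partitions with bounded parts\<close>

definition bounded_partitions :: "nat \<Rightarrow> nat list set" where
  "bounded_partitions N = {p. is_partition p \<and> set p \<subseteq> {..N}}"

lemma finite_bounded_partitions: "finite {p\<in>bounded_partitions N. sum_list p = n}"
proof (rule finite_subset)
  show "{p\<in>bounded_partitions N. sum_list p = n} \<subseteq> {p. set p \<subseteq> {..N} \<and> length p \<le> n}"
    by (auto simp: bounded_partitions_def dest: is_partition_length_le)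
qed (simp add: finite_lists_length_le)

lemma bounded_partitions_0: "bounded_partitions 0 = {[]}"
proof -
  have "p = []" if "p \<in> bounded_partitions 0" for p
    using that by (cases p) (auto simp: bounded_partitions_def is_partition_def)
  then show ?thesis
    by (auto simp: bounded_partitions_def is_partition_def)
qed

text \<open>The head is the largest part. If it equals \<open>Suc N\<close> it is removed once, and
  what remains may still contain \<open>Suc N\<close>; otherwise all parts are at most
  \<open>N\<close>.\<close>

lemma bounded_partitions_Suc:
  "bounded_partitions (Suc N) =
     bounded_partitions N \<union> (#) (Suc N) ` bounded_partitions (Suc N)"
proof (intro set_eqI iffI)
  fix p assume p: "p \<in> bounded_partitions (Suc N)"
  show "p \<in> bounded_partitions N \<union> (#) (Suc N) ` bounded_partitions (Suc N)"
  proof (cases p)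
    case Nil
    then show ?thesis
      by (simp add: bounded_partitions_def is_partition_def)
  next
    case (Cons a q)
    with p have q: "q \<in> bounded_partitions (Suc N)" "\<forall>x\<in>set q. x \<le> a" "a \<le> Suc N"
      by (auto simp: bounded_partitions_def is_partition_def)
    show ?thesis
    proof (cases "a = Suc N")
      case True
      with q Cons show ?thesis by blast
    next
      case False
      with q have "a \<le> N" "\<forall>x\<in>set q. x \<le> N" by auto
      with p Cons show ?thesis
        by (auto simp: bounded_partitions_def is_partition_def)
    qed
  qed
qed (auto simp: bounded_partitions_def is_partition_def intro: le_SucI)

lemma filter_Cons_image_sum_list:
  fixes a :: nat
  shows "{p\<in>(#) a ` A. sum_list p = n} =
         (if a \<le> n then (#) a ` {p\<in>A. sum_list p = n - a} else {})"
proof (cases "a \<le> n")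
  case True
  have "{p\<in>(#) a ` A. sum_list p = n} = (#) a ` {p\<in>A. a + sum_list p = n}"
    by auto
  also have "{p\<in>A. a + sum_list p = n} = {p\<in>A. sum_list p = n - a}"
    using True by (intro Collect_cong) linarith
  finally show ?thesis using True by simp
qed auto

text \<open>Removing one part \<open>Suc N\<close> adds a factor \<open>z\<close> and shifts
  exponents by \<open>Suc N\<close>: G(N+1) = G(N) + z q^(N+1) G(N+1). Clearing the denominator
  keeps this inside a commutative ring.\<close>

lemma length_gf_bounded_partitions_Suc:
  fixes z :: "'a::comm_ring_1"
  shows "length_gf (bounded_partitions (Suc N)) z * (1 - fps_const z * fps_X ^ Suc N) =
         length_gf (bounded_partitions N) z"
proof (rule fps_ext)
  fix n
  let ?B = "\<lambda>N n. {p\<in>bounded_partitions N. sum_list p = n}"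
  have filter_Un: "{x\<in>A \<union> B. Q x} = {x\<in>A. Q x} \<union> {x\<in>B. Q x}"
    for A B :: "nat list set" and Q
    by blast
  have "?B (Suc N) n = ?B N n \<union> {p\<in>(#) (Suc N) ` bounded_partitions (Suc N). sum_list p = n}"
    by (subst bounded_partitions_Suc) (rule filter_Un)
  also have "{p\<in>(#) (Suc N) ` bounded_partitions (Suc N). sum_list p = n} =
      (if Suc N \<le> n then (#) (Suc N) ` ?B (Suc N) (n - Suc N) else {})"
    by (rule filter_Cons_image_sum_list)
  finally have split: "?B (Suc N) n =
      ?B N n \<union> (if Suc N \<le> n then (#) (Suc N) ` ?B (Suc N) (n - Suc N) else {})" .
  have "Suc N # q \<notin> bounded_partitions N" for q
    by (simp add: bounded_partitions_def)
  then have disj: "?B N n \<inter> (#) (Suc N) ` ?B (Suc N) (n - Suc N) = {}"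
    by blast
  have sum_Cons: "(\<Sum>p\<in>(#) (Suc N) ` A. z ^ length p) = z * (\<Sum>p\<in>A. z ^ length p)" for A
    by (simp add: sum.reindex sum_distrib_left)
  have "(\<Sum>p\<in>?B (Suc N) n. z ^ length p) = (\<Sum>p\<in>?B N n. z ^ length p) +
      (if Suc N \<le> n then z * (\<Sum>p\<in>?B (Suc N) (n - Suc N). z ^ length p) else 0)"
  proof (cases "Suc N \<le> n")
    case True
    then have "?B (Suc N) n = ?B N n \<union> (#) (Suc N) ` ?B (Suc N) (n - Suc N)"
      using split by (simp only: if_True)
    then have "(\<Sum>p\<in>?B (Suc N) n. z ^ length p) = (\<Sum>p\<in>?B N n. z ^ length p) +
        (\<Sum>p\<in>(#) (Suc N) ` ?B (Suc N) (n - Suc N). z ^ length p)"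
      using disj by (simp only: sum.union_disjoint finite_bounded_partitions finite_imageI)
    with True show ?thesis
      by (simp only: sum_Cons if_True)
  next
    case False
    then show ?thesis
      using split by (simp only: if_False Un_empty_right add_0_right)
  qed
  then have rec: "length_gf (bounded_partitions (Suc N)) z $ n =
      length_gf (bounded_partitions N) z $ n +
      (if Suc N \<le> n then z * length_gf (bounded_partitions (Suc N)) z $ (n - Suc N) else 0)"
    unfolding length_gf_def fps_nth_Abs_fps .
  have "(f * (1 - fps_const z * fps_X ^ Suc N)) $ n =
      f $ n - (if Suc N \<le> n then z * f $ (n - Suc N) else 0)" for f
  proof -
    have "f * (1 - fps_const z * fps_X ^ Suc N) = f - fps_const z * (f * fps_X ^ Suc N)"
      by (simp only: right_diff_distrib mult_1_right mult.left_commute)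
    then show ?thesis
      by (simp add: fps_X_power_mult_right_nth del: power_Suc)
  qed
  then show "(length_gf (bounded_partitions (Suc N)) z * (1 - fps_const z * fps_X ^ Suc N)) $ n =
      length_gf (bounded_partitions N) z $ n"
    by (simp only: rec add_diff_cancel_right')
qed

lemma length_gf_bounded_partitions:
  fixes z :: "'a::field"
  shows "length_gf (bounded_partitions N) z = (\<Prod>i<N. inverse (1 - fps_const z * fps_X ^ Suc i))"
proof (induction N)
  case 0
  have "{p. p = [] \<and> sum_list p = n} = (if n = 0 then {[]} else {})" for n :: nat
    by auto
  then show ?case
    by (auto simp: length_gf_def bounded_partitions_0 fps_eq_iff)
next
  case (Suc N)
  let ?u = "1 - fps_const z * fps_X ^ Suc N"
  have "?u * inverse ?u = 1"
    by (rule inverse_mult_eq_1') simp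
  then have "length_gf (bounded_partitions (Suc N)) z =
      length_gf (bounded_partitions (Suc N)) z * ?u * inverse ?u"
    by (simp only: mult.assoc mult_1_right)
  also have "\<dots> = length_gf (bounded_partitions N) z * inverse ?u"
    by (simp only: length_gf_bounded_partitions_Suc)
  finally show ?case
    by (simp only: Suc.IH prod.lessThan_Suc)
qed

section \<open>Crank counts as coefficients of products\<close>

lemma colored_partitions_eq_tuples:
  assumes "n \<le> N"
  shows "colored_partitions k n = tuples (bounded_partitions N) k n"
proof -
  have "x \<le> N" if "ps \<in> colored_partitions k n" "p \<in> set ps" "x \<in> set p" for ps p x
  proof -
    have "x \<le> sum_list p"
      using that by (intro member_le_sum_list) auto
    also have "\<dots> \<le> n"
      using that member_le_sum_list[of "sum_list p" "map sum_list ps"]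
      by (auto simp: colored_partitions_def)
    finally show ?thesis using assms by simp
  qed
  then show ?thesis
    by (fastforce simp: colored_partitions_def tuples_def bounded_partitions_def)
qed

text \<open>Modulo 2 a difference agrees with a sum, so the sign attached to the crank has a natural
  number as exponent and splits over the components.\<close>

lemma crank_count_mod_2_diff:
  "real (crank_count_mod k 0 2 n) - real (crank_count_mod k 1 2 n) =
   (\<Sum>ps\<in>colored_partitions k n. (-1) ^ (length (ps ! 0) + length (ps ! 1)))"
proof -
  let ?s = "\<lambda>ps :: nat list list. length (ps ! 0) + length (ps ! 1)"
  have even: "[kcrank ps = 0] (mod 2) \<longleftrightarrow> even (?s ps)" for ps
    by (simp add: kcrank_def cong_def flip: even_iff_mod_2_eq_zero)
  have odd: "[kcrank ps = 1] (mod 2) \<longleftrightarrow> odd (?s ps)" for ps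
    by (simp add: kcrank_def cong_def flip: odd_iff_mod_2_eq_one)
  have card: "real (card {x\<in>A. R x}) = (\<Sum>x\<in>A. if R x then 1 else 0)"
    if "finite A" for A :: "nat list list set" and R
    using that by (simp add: sum.If_cases Int_def)
  show ?thesis
    unfolding crank_count_mod_def even odd card[OF finite_colored_partitions] sum_subtractf[symmetric]
    by (intro sum.cong) auto
qed

definition P_fps :: "nat \<Rightarrow> real fps" where
  "P_fps N = (\<Prod>i<N. inverse (1 - fps_X ^ Suc i))"

definition S_fps :: "nat \<Rightarrow> real fps" where
  "S_fps N = (\<Prod>i<N. inverse (1 + fps_X ^ Suc i))"

definition E_fps :: "nat \<Rightarrow> real fps" where
  "E_fps N = (\<Prod>i<N. inverse (1 - fps_X ^ (2 * Suc i)))"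

lemma crank_count_mod_2_diff_eq_nth:
  assumes "n \<le> N"
  shows "real (crank_count_mod (k + 2) 0 2 n) - real (crank_count_mod (k + 2) 1 2 n) =
         ((S_fps N)\<^sup>2 * P_fps N ^ k) $ n"
proof -
  \<comment> \<open>The two colors entering the crank get weight -1 and yield S^2; the other
    \<open>k\<close> get weight 1 and yield P^k.\<close>
  let ?zs = "-1 # -1 # replicate k (1::real)"
  have ones: "(\<Prod>(z, p)\<leftarrow>zip (replicate k (1::real)) qs. z ^ length p) = 1" for qs :: "nat list list"
  proof (induction qs arbitrary: k)
    case (Cons q qs)
    then show ?case by (cases k) auto
  qed simp
  have "(\<Prod>(z, p)\<leftarrow>zip ?zs ps. z ^ length p) = (-1) ^ (length (ps ! 0) + length (ps ! 1))"
    if ps: "ps \<in> tuples (bounded_partitions N) (k + 2) n" for ps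
  proof -
    obtain a b qs where "ps = a # b # qs"
      using ps by (auto simp: tuples_def length_Suc_conv)
    then show ?thesis
      by (simp add: ones power_add)
  qed
  then have "real (crank_count_mod (k + 2) 0 2 n) - real (crank_count_mod (k + 2) 1 2 n) =
      (\<Sum>ps\<in>tuples (bounded_partitions N) (length ?zs) n. \<Prod>(z, p)\<leftarrow>zip ?zs ps. z ^ length p)"
    unfolding crank_count_mod_2_diff colored_partitions_eq_tuples[OF assms] by simp
  also have "\<dots> = (\<Prod>z\<leftarrow>?zs. length_gf (bounded_partitions N) z) $ n"
    by (rule sum_tuples_eq_prod_length_gf[OF finite_bounded_partitions])
  also have "(\<Prod>z\<leftarrow>?zs. length_gf (bounded_partitions N) z) = (S_fps N)\<^sup>2 * P_fps N ^ k"
    by (simp add: length_gf_bounded_partitions S_fps_def P_fps_def power2_eq_square prod_list_replicate mult.assoc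
        flip: fps_const_neg)
  finally show ?thesis .
qed

section \<open>Identities between the three products\<close>

lemma inverse_one_plus_mult_inverse_one_minus:
  fixes y :: "'a::field fps"
  shows "inverse (1 + y) * inverse (1 - y) = inverse (1 - y\<^sup>2)"
proof -
  have "1 - y\<^sup>2 = (1 + y) * (1 - y)"
    by (simp add: algebra_simps power2_eq_square)
  then show ?thesis
    by (simp only: fps_inverse_mult)
qed

text \<open>This is the form in which Euler's product telescopes. The hypothesis makes
  \<open>1 - y\<close> invertible.\<close>

lemma inverse_one_plus:
  fixes y :: "'a::field fps"
  assumes "y $ 0 = 0"
  shows "inverse (1 + y) = (1 - y) * inverse (1 - y\<^sup>2)"
proof -
  have cancel: "(1 - y) * inverse (1 - y) = 1"
    using assms by (intro inverse_mult_eq_1') simp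
  have "(1 - y) * inverse (1 - y\<^sup>2) = inverse (1 + y) * ((1 - y) * inverse (1 - y))"
    by (simp only: mult_ac flip: inverse_one_plus_mult_inverse_one_minus)
  then show ?thesis
    by (simp only: cancel mult_1_right)
qed

lemma S_fps_mult_P_fps: "S_fps N * P_fps N = E_fps N"
  by (simp only: S_fps_def P_fps_def E_fps_def prod.distrib[symmetric] power_even_eq
      inverse_one_plus_mult_inverse_one_minus)

text \<open>Euler's theorem on partitions into odd and into distinct parts, with the error term that the
  truncation leaves.\<close>

lemma S_fps_even:
  "S_fps (2 * M) = (\<Prod>j<M. 1 - fps_X ^ Suc (2 * j)) *
                   (\<Prod>j\<in>{M..<2 * M}. inverse (1 - fps_X ^ (2 * Suc j)))"
proof (induction M)
  case (Suc M)
  let ?u = "\<lambda>i. 1 - fps_X ^ Suc i :: real fps"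
  let ?a = "\<lambda>j. inverse (1 - fps_X ^ (2 * Suc j)) :: real fps"
  have S_Suc: "S_fps (Suc N) = S_fps N * (?u N * ?a N)" for N
    unfolding S_fps_def prod.lessThan_Suc power_even_eq by (subst inverse_one_plus[symmetric]) simp_all
  \<comment> \<open>Passing from \<open>M\<close> to \<open>Suc M\<close> adds the numerators 1 -
    q^(2M+1), which is kept, and 1 - q^(2M+2), which cancels the first factor of the tail.\<close>
  have cancel: "?u (Suc (2 * M)) * ?a M = 1"
    using inverse_mult_eq_1'[of "1 - fps_X ^ (2 * Suc M) :: real fps"] by simp
  have range: "prod a {M..<2 * M} * a (2 * M) * a (Suc (2 * M)) = a M * prod a {Suc M..<2 * Suc M}"
    for a :: "nat \<Rightarrow> real fps"
  proof -
    have "prod a {M..<2 * M} * a (2 * M) * a (Suc (2 * M)) = prod a {M..<2 * Suc M}"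
      by simp
    also have "\<dots> = a M * prod a {Suc M..<2 * Suc M}"
      by (rule prod.atLeast_Suc_lessThan) simp
    finally show ?thesis .
  qed
  have regroup1: "(a * b) * (u * x) * (v * y) = (a * u) * v * (b * x * y)"
    and regroup2: "a * v * (x * b) = a * (v * x) * b" for a b u v x y :: "real fps"
    by (simp_all only: mult_ac)
  have "S_fps (2 * Suc M) =
      S_fps (2 * M) * (?u (2 * M) * ?a (2 * M)) * (?u (Suc (2 * M)) * ?a (Suc (2 * M)))"
    by (simp only: S_Suc mult_Suc_right add_2_eq_Suc)
  also have "\<dots> = ((\<Prod>j<M. ?u (2 * j)) * ?u (2 * M)) * ?u (Suc (2 * M)) *
      (prod ?a {M..<2 * M} * ?a (2 * M) * ?a (Suc (2 * M)))"
    unfolding Suc.IH by (rule regroup1)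
  also have "\<dots> = ((\<Prod>j<M. ?u (2 * j)) * ?u (2 * M)) * (?u (Suc (2 * M)) * ?a M) *
      prod ?a {Suc M..<2 * Suc M}"
    unfolding range[of ?a] by (rule regroup2)
  finally show ?case
    unfolding cancel by (simp only: mult_1_right prod.lessThan_Suc)
qed (simp add: S_fps_def)

section \<open>Signs of coefficients\<close>

text \<open>The condition concerns the coefficients of \<open>f(c q)\<close>, for \<open>c = 1\<close> and \<open>c = -1\<close>.\<close>

definition twisted_nonneg :: "real \<Rightarrow> real fps \<Rightarrow> bool" where
  "twisted_nonneg c f \<longleftrightarrow> (\<forall>n. 0 \<le> c ^ n * f $ n)"

text \<open>Substituting c q for q is multiplicative, so the twisted coefficients also obey the
  Cauchy product, and signs can be read off term by term.\<close>

lemma twisted_mult_nth: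
  fixes f g :: "real fps"
  shows "c ^ n * (f * g) $ n = (\<Sum>i\<le>n. (c ^ i * f $ i) * (c ^ (n - i) * g $ (n - i)))"
proof -
  have "c ^ n * (f $ i * g $ (n - i)) = (c ^ i * f $ i) * (c ^ (n - i) * g $ (n - i))"
    if "i \<le> n" for i
    using that power_add[of c i "n - i"] by simp
  then show ?thesis
    unfolding fps_mult_nth sum_distrib_left atLeast0AtMost by (intro sum.cong) simp_all
qed

lemma twisted_nonneg_1: "twisted_nonneg c 1"
  by (simp add: twisted_nonneg_def fps_one_nth)

lemma twisted_nonneg_mult:
  assumes "twisted_nonneg c f" "twisted_nonneg c g"
  shows "twisted_nonneg c (f * g)"
  unfolding twisted_nonneg_def twisted_mult_nth
proof (intro allI sum_nonneg)
  fix n i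
  show "0 \<le> c ^ i * f $ i * (c ^ (n - i) * g $ (n - i))"
    using assms unfolding twisted_nonneg_def by (intro mult_nonneg_nonneg[of "_ * _"]) auto
qed

lemma twisted_nonneg_prod:
  "(\<And>i. i \<in> A \<Longrightarrow> twisted_nonneg c (f i)) \<Longrightarrow> twisted_nonneg c (prod f A)"
  by (induction A rule: infinite_finite_induct)
     (auto intro: twisted_nonneg_1 twisted_nonneg_mult)

lemma twisted_nonneg_power: "twisted_nonneg c f \<Longrightarrow> twisted_nonneg c (f ^ n)"
  by (induction n) (auto intro: twisted_nonneg_1 twisted_nonneg_mult)

lemma twisted_mult_nth_pos:
  assumes "twisted_nonneg c f" "twisted_nonneg c g"
    and "0 < c ^ i * f $ i" "0 < c ^ j * g $ j"
  shows "0 < c ^ (i + j) * (f * g) $ (i + j)"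
  unfolding twisted_mult_nth
proof (rule sum_pos2[of _ i])
  show "0 < (c ^ i * f $ i) * (c ^ (i + j - i) * g $ (i + j - i))"
    using assms(3,4) by (intro mult_pos_pos[of "_ * _"]) simp_all
  show "0 \<le> (c ^ l * f $ l) * (c ^ (i + j - l) * g $ (i + j - l))" for l
    using assms(1,2) unfolding twisted_nonneg_def by (intro mult_nonneg_nonneg[of "_ * _"]) auto
qed simp_all

text \<open>One positive term suffices: the coefficient of q^n from factor \<open>a\<close> times
  the constant term 1 of all other factors.\<close>

lemma twisted_prod_nth_pos:
  assumes "finite A" "a \<in> A" "\<And>i. i \<in> A \<Longrightarrow> twisted_nonneg c (f i)"
    and "\<And>i. i \<in> A \<Longrightarrow> f i $ 0 = 1" "0 < c ^ n * f a $ n"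
  shows "0 < c ^ n * prod f A $ n"
proof -
  have "(\<Prod>i\<in>A - {a}. f i) $ 0 = 1"
    using assms by (simp add: fps_prod_nth_0)
  moreover have "twisted_nonneg c (\<Prod>i\<in>A - {a}. f i)"
    using assms by (intro twisted_nonneg_prod) simp
  ultimately show ?thesis
    using twisted_mult_nth_pos[of c "f a" "\<Prod>i\<in>A - {a}. f i" n 0] assms
    by (simp add: prod.remove[of A a])
qed

section \<open>Signs of the coefficients of E, P and S\<close>

lemma inverse_one_minus_fps_X_power_nth:
  assumes "0 < m"
  shows "inverse (1 - fps_X ^ m :: 'a::field fps) $ n = (if m dvd n then 1 else 0)"
proof -
  have "(1 - fps_X ^ m) * Abs_fps (\<lambda>n. if m dvd n then 1 else 0) = (1 :: 'a fps)"
    using assms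
    by (auto simp: fps_eq_iff left_diff_distrib fps_X_power_mult_nth fps_one_nth dvd_minus_self
        dest: dvd_imp_le)
  then have "inverse (1 - fps_X ^ m :: 'a fps) = Abs_fps (\<lambda>n. if m dvd n then 1 else 0)"
    by (intro fps_inverse_unique)
  then show ?thesis by simp
qed

text \<open>Only even exponents occur, and there \<open>c ^ n\<close> is 1 for both values of
  \<open>c\<close>.\<close>

lemma twisted_nonneg_inverse_even:
  "c = 1 \<or> c = -1 \<Longrightarrow> twisted_nonneg c (inverse (1 - fps_X ^ (2 * Suc i)))"
  by (auto simp: twisted_nonneg_def inverse_one_minus_fps_X_power_nth simp del: mult_Suc_right
      elim!: dvdE)

lemma twisted_nonneg_E_fps: "c = 1 \<or> c = -1 \<Longrightarrow> twisted_nonneg c (E_fps N)"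
  unfolding E_fps_def by (intro twisted_nonneg_prod twisted_nonneg_inverse_even)

text \<open>The factor 1/(1 - q^2), present since \<open>0 < N\<close>, already has coefficient 1 at
  every even exponent.\<close>

lemma E_fps_nth_pos:
  assumes "0 < N" "c = 1 \<or> c = -1" "even n"
  shows "0 < c ^ n * E_fps N $ n"
  unfolding E_fps_def using assms
  by (intro twisted_prod_nth_pos[where a = 0] twisted_nonneg_inverse_even)
     (auto simp: inverse_one_minus_fps_X_power_nth simp del: power_Suc)

lemma twisted_nonneg_P_fps: "twisted_nonneg 1 (P_fps N)"
  unfolding P_fps_def by (intro twisted_nonneg_prod)
    (simp add: twisted_nonneg_def inverse_one_minus_fps_X_power_nth del: power_Suc)

lemma P_fps_nth_pos:
  assumes "0 < N"
  shows "0 < P_fps N $ n"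
proof -
  have "0 < 1 ^ n * P_fps N $ n"
    unfolding P_fps_def using assms
    by (intro twisted_prod_nth_pos[where a = 0])
       (auto simp: twisted_nonneg_def inverse_one_minus_fps_X_power_nth
          inverse_one_minus_fps_X_power_nth[of 1, simplified] simp del: power_Suc)
  then show ?thesis by simp
qed

lemma twisted_nonneg_one_minus_odd: "twisted_nonneg (-1) (1 - fps_X ^ Suc (2 * j))"
  by (auto simp: twisted_nonneg_def fps_one_nth fps_X_power_nth simp del: power_Suc)

lemma twisted_nonneg_S_fps: "twisted_nonneg (-1) (S_fps (2 * M))"
  unfolding S_fps_even
  by (intro twisted_nonneg_mult twisted_nonneg_prod twisted_nonneg_one_minus_odd
      twisted_nonneg_inverse_even) auto

lemma S_fps_nth_0: "S_fps N $ 0 = 1"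
  by (simp add: S_fps_def fps_prod_nth_0)

text \<open>For odd \<open>n\<close> below \<open>2 * M\<close> the factor 1 - q^n itself occurs in
  Euler's form; the tail product contributes its constant term.\<close>

lemma S_fps_nth_pos:
  assumes "odd n" "n < 2 * M"
  shows "0 < (-1) ^ n * S_fps (2 * M) $ n"
proof -
  obtain j where j: "n = Suc (2 * j)" "j < M"
    using assms by (auto elim!: oddE)
  let ?a = "\<Prod>j<M. 1 - fps_X ^ Suc (2 * j) :: real fps"
  let ?b = "\<Prod>j\<in>{M..<2 * M}. inverse (1 - fps_X ^ (2 * Suc j)) :: real fps"
  have "0 < (-1) ^ n * ?a $ n"
    using j by (intro twisted_prod_nth_pos[where a = j] twisted_nonneg_one_minus_odd)
      (auto simp: fps_one_nth fps_X_power_nth simp del: power_Suc)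
  moreover have "?b $ 0 = 1"
    by (simp add: fps_prod_nth_0)
  moreover have "twisted_nonneg (-1) ?a" "twisted_nonneg (-1) ?b"
    by (intro twisted_nonneg_prod twisted_nonneg_one_minus_odd twisted_nonneg_inverse_even; simp)+
  ultimately show ?thesis
    unfolding S_fps_even using twisted_mult_nth_pos[of "-1" ?a ?b n 0] by simp
qed

section \<open>Signs for the products belonging to each number of colors\<close>

lemma S_fps_square_nth_pos:
  assumes "n < 2 * M"
  shows "0 < (-1) ^ n * ((S_fps (2 * M))\<^sup>2) $ n"
proof -
  note nn = twisted_nonneg_S_fps[of M]
  have zero: "0 < (-1) ^ 0 * S_fps (2 * M) $ 0"
    by (simp add: S_fps_nth_0)
  \<comment> \<open>Positivity for one factor is known only at 0 and at odd exponents, so a positive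
    even \<open>n\<close> is written as a sum of two odd numbers.\<close>
  consider "n = 0" | "odd n" | m where "n = 1 + m" "odd m"
    by (cases n) auto
  then show ?thesis
  proof cases
    case 1
    then show ?thesis
      using twisted_mult_nth_pos[OF nn nn zero zero] by (simp add: power2_eq_square)
  next
    case 2
    then show ?thesis
      using twisted_mult_nth_pos[OF nn nn S_fps_nth_pos[OF 2 assms] zero]
      by (simp add: power2_eq_square)
  next
    case 3
    then have "0 < (-1) ^ 1 * S_fps (2 * M) $ 1" "0 < (-1) ^ m * S_fps (2 * M) $ m"
      using assms by (intro S_fps_nth_pos; simp)+
    from twisted_mult_nth_pos[OF nn nn this] show ?thesis
      unfolding 3 power2_eq_square .
  qed
qed

text \<open>For even \<open>n\<close> the positive term pairs the constant term of S with E at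
  \<open>n\<close>; for odd \<open>n\<close> it pairs S at \<open>n\<close> with the constant term
  of E.\<close>

lemma S_fps_mult_E_fps_nth_pos:
  assumes "n < 2 * M"
  shows "0 < (-1) ^ n * (S_fps (2 * M) * E_fps (2 * M)) $ n"
proof (cases "even n")
  case True
  have "0 < (-1) ^ 0 * S_fps (2 * M) $ 0"
    by (simp add: S_fps_nth_0)
  from twisted_mult_nth_pos[OF twisted_nonneg_S_fps twisted_nonneg_E_fps this E_fps_nth_pos]
  show ?thesis
    using assms True by fastforce
next
  case False
  from twisted_mult_nth_pos[OF twisted_nonneg_S_fps twisted_nonneg_E_fps
      S_fps_nth_pos[OF False assms] E_fps_nth_pos[of _ _ 0]]
  show ?thesis
    using assms by simp
qed

lemma E_fps_square_nth_pos:
  assumes "0 < N" "even n"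
  shows "0 < ((E_fps N)\<^sup>2) $ n"
  using twisted_mult_nth_pos[OF twisted_nonneg_E_fps twisted_nonneg_E_fps
      E_fps_nth_pos[of N 1 n] E_fps_nth_pos[of N 1 0]] assms
  by (simp add: power2_eq_square)

text \<open>Nonnegativity for both \<open>c = 1\<close> and \<open>c = -1\<close> bounds an odd
  coefficient by 0 from both sides.\<close>

lemma E_fps_square_nth_odd:
  assumes "odd n"
  shows "((E_fps N)\<^sup>2) $ n = 0"
proof -
  have "0 \<le> c ^ n * ((E_fps N)\<^sup>2) $ n" if "c = 1 \<or> c = -1" for c
    using twisted_nonneg_power[OF twisted_nonneg_E_fps[OF that]] unfolding twisted_nonneg_def by blast
  from this[of 1] this[of "-1"] show ?thesis
    using assms by simp
qed

text \<open>One factor P, all of whose coefficients are positive, is split off; the rest has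
  constant term 1 and nonnegative coefficients.\<close>

lemma E_fps_square_mult_P_fps_power_nth_pos:
  assumes "0 < N"
  shows "0 < ((E_fps N)\<^sup>2 * P_fps N ^ Suc k) $ n"
proof -
  have nn: "twisted_nonneg 1 ((E_fps N)\<^sup>2 * P_fps N ^ k)"
    by (intro twisted_nonneg_mult twisted_nonneg_power twisted_nonneg_E_fps twisted_nonneg_P_fps) simp
  have "((E_fps N)\<^sup>2 * P_fps N ^ k) $ 0 = 1"
    by (simp add: E_fps_def P_fps_def fps_prod_nth_0 fps_power_zeroth)
  then show ?thesis
    using twisted_mult_nth_pos[OF nn twisted_nonneg_P_fps, of 0 n] P_fps_nth_pos[OF assms]
    by (simp add: mult_ac)
qed

theorem theorem1p4:
  fixes n :: nat
  shows "(\<forall>k\<in>{2, 3, 4}. crank_count_mod k 0 2 (2 * n) > crank_count_mod k 1 2 (2 * n)) \<and>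
         (\<forall>k\<in>{2, 3}. crank_count_mod k 1 2 (2 * n + 1) > crank_count_mod k 0 2 (2 * n + 1)) \<and>
         crank_count_mod 4 0 2 (2 * n + 1) = crank_count_mod 4 1 2 (2 * n + 1) \<and>
         (\<forall>k\<ge>5. crank_count_mod k 0 2 n > crank_count_mod k 1 2 n)"
proof -
  define d where "d k m = real (crank_count_mod k 0 2 m) - real (crank_count_mod k 1 2 m)" for k m
  \<comment> \<open>Euler's form needs an even bound \<open>2 * M\<close>, and the positivity lemmas
    need \<open>m < 2 * M\<close>; \<open>M = Suc m\<close> meets both.\<close>
  define N where "N m = 2 * Suc m" for m
  have d: "d k m = ((S_fps (N m))\<^sup>2 * P_fps (N m) ^ (k - 2)) $ m" if "2 \<le> k" for k m
    unfolding d_def using crank_count_mod_2_diff_eq_nth[of m "N m" "k - 2"] that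
    by (simp only: le_add_diff_inverse2) (simp add: N_def)
  have E: "(E_fps (N m))\<^sup>2 = (S_fps (N m))\<^sup>2 * (P_fps (N m))\<^sup>2" for m
    by (simp only: power_mult_distrib flip: S_fps_mult_P_fps)
  have d2: "0 < (-1) ^ m * d 2 m" for m
    using S_fps_square_nth_pos[of m "Suc m"] by (simp add: d N_def)
  have d3: "0 < (-1) ^ m * d 3 m" for m
  proof -
    have "d 3 m = (S_fps (N m) * E_fps (N m)) $ m"
      by (simp add: d power2_eq_square mult.assoc flip: S_fps_mult_P_fps)
    then show ?thesis
      using S_fps_mult_E_fps_nth_pos[of m "Suc m"] by (simp add: N_def)
  qed
  have d4: "d 4 m = ((E_fps (N m))\<^sup>2) $ m" for m
    by (simp add: d E)
  have d5: "0 < d k m" if k: "5 \<le> k" for k m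
  proof -
    \<comment> \<open>Two of the factors P combine with S^2 into E^2, and \<open>5 \<le> k\<close>
      leaves at least one more.\<close>
    have "k - 2 = 2 + Suc (k - 5)"
      using k by simp
    then have "d k m = ((E_fps (N m))\<^sup>2 * P_fps (N m) ^ Suc (k - 5)) $ m"
      using k by (simp only: d E power_add mult.assoc)
    then show ?thesis
      using E_fps_square_mult_P_fps_power_nth_pos[of "N m" "k - 5" m] by (simp only: N_def) simp
  qed
  have "0 < d 2 (2 * n)" "0 < d 3 (2 * n)" "d 2 (2 * n + 1) < 0" "d 3 (2 * n + 1) < 0"
    using d2[of "2 * n"] d3[of "2 * n"] d2[of "2 * n + 1"] d3[of "2 * n + 1"] by simp_all
  moreover have "0 < d 4 (2 * n)" "d 4 (2 * n + 1) = 0"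
    unfolding d4 by (intro E_fps_square_nth_pos E_fps_square_nth_odd; simp add: N_def)+
  ultimately show ?thesis
    using d5[of _ n] by (simp add: d_def)
qed

end
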